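(* Let $n>2$. Then the set of values $\{(n-1)\text{-affinity}(f): f\in\mathrm{Per}(\mathbb{F}_2^n)\}$ equals $\{2^i-2: 1\le i\le n+1\}$.
   Context: $\mathrm{Per}(\mathbb{F}_2^n)$ is the group of permutations of $\mathbb{F}_2^n$. An $(n-1)$-flat is a coset of an $(n-1)$-dimensional subspace; $(n-1)\text{-affinity}(f)$ is the number of $(n-1)$-flats $X$ such that $f(X)$ is also an $(n-1)$-flat. *)

theory Defs
  imports "HOL-Analysis.Cartesian_Space" "HOL-Library.Z2"
begin

definition is_flat :: "nat \<Rightarrow> ('a::field ^ 'n) set \<Rightarrow> bool" where
  "is_flat k X \<longleftrightarrow> (\<exists>a W. vec.subspace W \<and> vec.dim W = k \<and> X = (+) a ` W)"

definition affinity :: "nat \<Rightarrow> ('a::field ^ 'n \<Rightarrow> 'a ^ 'n) \<Rightarrow> nat" where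
  "affinity k f = card {X. is_flat k X \<and> is_flat k (f ` X)}"

end

theory Submission
  imports Defs "HOL-Combinatorics.Transposition"
begin

text \<open>
  Over \<open>\<bbbF>\<^sub>2\<close> the \<open>(n-1)\<close>-flats are the solution sets of \<open>a \<bullet> x = c\<close> with \<open>a \<noteq> 0\<close>, and \<open>(a, c)\<close> is
  determined by the flat. A bijection \<open>f\<close> maps such a flat to a flat iff \<open>x \<mapsto> a \<bullet> x\<close> is an affine
  function of \<open>f x\<close>. The \<open>a\<close> with this property form a subspace, of size \<open>2\<^sup>k\<close> say, so the affinity
  is \<open>2 (2\<^sup>k - 1)\<close>.

  Conversely, let \<open>f\<close> be a cycle on \<open>0\<close> and the unit vectors \<open>e\<^sub>i\<close>, \<open>i \<in> M\<close>. If \<open>a \<bullet> x\<close> is an affine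
  function of \<open>f x\<close>, then \<open>a \<bullet> x\<close> agrees with an affine function of \<open>x\<close> off the support of \<open>f\<close>,
  in particular at all vectors of weight at least 2; for \<open>n > 2\<close> this makes them equal, so
  \<open>a \<bullet> x\<close> is invariant under the cycle, which means \<open>a\<^sub>i = 0\<close> for \<open>i \<in> M\<close>. This
  realises every \<open>k = n - |M|\<close>.
\<close>

definition dot :: "bit ^ 'n \<Rightarrow> bit ^ 'n \<Rightarrow> bit" where
  "dot a x = (\<Sum>i\<in>UNIV. a $ i * x $ i)"

definition hyperplane :: "bit ^ 'n \<Rightarrow> bit \<Rightarrow> (bit ^ 'n) set" where
  "hyperplane a c = {x. dot a x = c}"

definition affine_preserved :: "(bit ^ 'n \<Rightarrow> bit ^ 'n) \<Rightarrow> (bit ^ 'n) set" where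
  "affine_preserved f = {a. \<exists>b d. \<forall>x. dot a x = dot b (f x) + d}"

section \<open>Arithmetic in characteristic two and the dot product\<close>

lemma UNIV_bit: "(UNIV :: bit set) = {0, 1}"
  by auto

instance bit :: finite
  by standard (simp add: UNIV_bit)

lemma CARD_bit [simp]: "CARD(bit) = 2"
  by (simp add: UNIV_bit)

text \<open>These default rules turn sums of bits into conditionals.\<close>

declare add_bit_eq_xor [simp del] mult_bit_eq_and [simp del]

lemma bit_add_self [simp]: "b + b = (0 :: bit)"
  by (cases b) (simp_all add: add_bit_eq_xor)

lemma bit_add_cancel [simp]: "b + (b + c) = (c :: bit)"
  by (simp add: add.assoc [symmetric])

lemma bit_vec_add_self [simp]: "x + x = (0 :: bit ^ 'n)"
  by (simp add: vec_eq_iff)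

lemma bit_vec_minus [simp]: "x - y = (x + y :: bit ^ 'n)"
  by (simp add: vec_eq_iff)

lemma bit_vec_add_cancel [simp]: "x + (x + y) = (y :: bit ^ 'n)"
  by (simp add: add.assoc [symmetric])

lemma dot_add_right: "dot a (x + y) = dot a x + dot a y"
  by (simp add: dot_def distrib_left sum.distrib)

lemma dot_add_left: "dot (a + b) x = dot a x + dot b x"
  by (simp add: dot_def distrib_right sum.distrib)

lemma dot_zero [simp]: "dot a 0 = 0" "dot 0 x = 0"
  by (simp_all add: dot_def)

lemma dot_scale_right: "dot a (k *s x) = k * dot a x"
  by (simp add: dot_def sum_distrib_left mult.left_commute)

lemma dot_axis [simp]: "dot a (axis i 1) = a $ i"
  by (simp add: dot_def axis_def if_distrib cong: if_cong)

lemma axis_index_if: "axis i x $ j = (if j = i then x else 0)"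
  by (simp add: axis_def)

lemma dot_eq_iff: "(\<forall>x. dot a x = dot b x) \<longleftrightarrow> a = b"
  by (metis dot_axis vec_eq_iff)

section \<open>Sizes of spans and subspaces\<close>

lemma card_span_bit:
  fixes B :: "(bit ^ 'n) set"
  assumes "finite B" "vec.independent B"
  shows "card (vec.span B) = 2 ^ card B"
  using assms
proof (induction rule: finite_induct)
  case empty
  then show ?case by simp
next
  case (insert a B)
  then have ind: "vec.independent B" and a: "a \<notin> vec.span B"
    by (auto simp: vec.independent_insert)
  \<comment> \<open>The only scalars are 0 and 1, so a new independent vector contributes one
    disjoint translate of the old span, which doubles the size.\<close>
  have "vec.span (insert a B) = vec.span B \<union> (+) a ` vec.span B"
  proof (intro set_eqI iffI)
    fix x assume "x \<in> vec.span (insert a B)"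
    then obtain k where k: "x - k *s a \<in> vec.span B"
      by (auto simp: vec.span_insert)
    show "x \<in> vec.span B \<union> (+) a ` vec.span B"
    proof (cases "k = 0")
      case True
      with k show ?thesis by simp
    next
      case False
      with k have "a + x \<in> vec.span B"
        by (simp add: add.commute)
      then have "a + (a + x) \<in> (+) a ` vec.span B"
        by (rule imageI)
      then show ?thesis by simp
    qed
  next
    fix x assume "x \<in> vec.span B \<union> (+) a ` vec.span B"
    moreover have "vec.span B \<subseteq> vec.span (insert a B)"
      by (intro vec.span_mono) blast
    moreover have "a \<in> vec.span (insert a B)"
      by (intro vec.span_base) blast
    ultimately show "x \<in> vec.span (insert a B)"
      by (auto intro!: vec.span_add)
  qed
  moreover have "vec.span B \<inter> (+) a ` vec.span B = {}"
  proof (rule ccontr)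
    assume "vec.span B \<inter> (+) a ` vec.span B \<noteq> {}"
    then obtain y where y: "y \<in> vec.span B" "a + y \<in> vec.span B"
      by auto
    then have "(a + y) - y \<in> vec.span B"
      using vec.span_diff by blast
    with a show False
      by (simp add: add.assoc)
  qed
  moreover have "card ((+) a ` vec.span B) = card (vec.span B)"
    by (rule card_image) simp
  ultimately show ?case
    using insert ind by (simp add: card_Un_disjoint)
qed

text \<open>Lets dimensions be read off from cardinalities and conversely, so that codimension 1
  becomes "half of the space".\<close>

lemma card_subspace_bit:
  fixes W :: "(bit ^ 'n) set"
  assumes "vec.subspace W"
  shows "card W = 2 ^ vec.dim W"
proof -
  obtain B where B: "B \<subseteq> W" "vec.independent B" "W \<subseteq> vec.span B" "card B = vec.dim W"
    using vec.basis_exists by blast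
  then have "vec.span B = W"
    using assms vec.span_minimal by blast
  with card_span_bit [of B] B show ?thesis
    by (simp add: vec.finiteI_independent)
qed

section \<open>Flats of codimension one as level sets of functionals\<close>

lemma subspace_hyperplane: "vec.subspace (hyperplane a 0)"
  by (auto simp: vec.subspace_def hyperplane_def dot_add_right dot_scale_right)

lemma dot_surj: "a \<noteq> 0 \<Longrightarrow> \<exists>p. dot a p = c"
  by (metis (full_types) bit_not_zero_iff dot_axis dot_zero(1) vec_eq_iff zero_index)

lemma hyperplane_translate: "dot a p = c \<Longrightarrow> (+) p ` hyperplane a 0 = hyperplane a c"
proof (intro set_eqI iffI)
  fix x assume "dot a p = c" "x \<in> hyperplane a c"
  then have "p + x \<in> hyperplane a 0"
    by (simp add: hyperplane_def dot_add_right)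
  then have "p + (p + x) \<in> (+) p ` hyperplane a 0"
    by (rule imageI)
  then show "x \<in> (+) p ` hyperplane a 0" by simp
qed (auto simp: hyperplane_def dot_add_right)

text \<open>The two level sets of \<open>dot a\<close> are translates of each other and partition
  the space, so each is half of it.\<close>

lemma card_hyperplane:
  fixes a :: "bit ^ 'n"
  assumes "a \<noteq> 0"
  shows "card (hyperplane a 0) = 2 ^ (CARD('n) - 1)"
proof -
  obtain p where p: "dot a p = 1"
    using dot_surj [OF assms] by blast
  have "card (hyperplane a 1) = card (hyperplane a 0)"
    by (subst hyperplane_translate [OF p, symmetric], rule card_image) simp
  moreover have "UNIV = hyperplane a 0 \<union> hyperplane a 1"
    by (auto simp: hyperplane_def)
  moreover have "hyperplane a 0 \<inter> hyperplane a 1 = {}"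
    by (auto simp: hyperplane_def)
  ultimately have "CARD(bit ^ 'n) = 2 * card (hyperplane a 0)"
    by (metis card_Un_disjoint finite mult_2)
  moreover have "CARD(bit ^ 'n) = 2 * 2 ^ (CARD('n) - 1)"
    by (simp flip: power_Suc)
  ultimately show ?thesis by simp
qed

text \<open>With 0 and 1 as the only scalars, additivity already gives linearity; the coefficients
  are the values at the unit vectors.\<close>

lemma additive_bit_eq_dot:
  fixes g :: "bit ^ 'n \<Rightarrow> bit"
  assumes "\<And>x y. g (x + y) = g x + g y"
  shows "\<exists>a. \<forall>x. g x = dot a x"
proof -
  have g0: "g 0 = 0"
    using assms [of 0 0] by simp
  have sum: "g (\<Sum>i\<in>A. h i) = (\<Sum>i\<in>A. g (h i))" if "finite A" for A :: "'n set" and h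
    using that by induction (simp_all add: g0 assms)
  have scale: "g (k *s x) = g x * k" for k x
    by (cases k) (simp_all add: g0)
  have "g x = dot (\<chi> i. g (axis i 1)) x" for x
    by (subst basis_expansion [symmetric]) (simp only: sum scale dot_def finite vec_lambda_beta)
  then show ?thesis by blast
qed

text \<open>A subgroup of index 2 is the kernel of its complement's indicator.\<close>

lemma subspace_eq_hyperplane:
  fixes W :: "(bit ^ 'n) set"
  assumes W: "vec.subspace W" and dim: "vec.dim W = CARD('n) - 1"
  shows "\<exists>a. a \<noteq> 0 \<and> W = hyperplane a 0"
proof -
  have card: "2 * card W = CARD(bit ^ 'n)"
    by (simp add: card_subspace_bit [OF W] dim flip: power_Suc)
  have add_iff: "x + y \<in> W \<longleftrightarrow> y \<in> W" if "x \<in> W" for x y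
    using that vec.subspace_add [OF W] by (metis bit_vec_add_cancel)
  have add_out: "x + y \<in> W" if x: "x \<notin> W" and y: "y \<notin> W" for x y
  proof -
    \<comment> \<open>The coset of \<open>x\<close> misses \<open>W\<close> and is as large as the
      complement, hence equals it; so \<open>y = x + w\<close>, and \<open>x + y = w\<close> in
      characteristic two.\<close>
    have "(+) x ` W \<subseteq> - W"
      using x add_iff by (auto simp: add.commute)
    moreover have "card ((+) x ` W) = card (- W)"
      using card by (simp add: card_image Compl_eq_Diff_UNIV card_Diff_subset)
    ultimately have "(+) x ` W = - W"
      by (simp add: card_subset_eq)
    with y obtain w where "w \<in> W" "y = x + w"
      by auto
    then show ?thesis by simp
  qed
  define g :: "bit ^ 'n \<Rightarrow> bit" where "g x = (if x \<in> W then 0 else 1)" for x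
  have "g (x + y) = g x + g y" for x y
    using add_iff [of x y] add_iff [of y x] add_out [of x y]
    by (auto simp: g_def add.commute)
  then obtain a where a: "\<And>x. g x = dot a x"
    using additive_bit_eq_dot by blast
  have "W = hyperplane a 0"
    by (auto simp: hyperplane_def a [symmetric] g_def split: if_splits)
  moreover have "W \<noteq> UNIV"
    using card by auto
  moreover have "hyperplane (0 :: bit ^ 'n) 0 = UNIV"
    by (simp add: hyperplane_def)
  ultimately show ?thesis by metis
qed

lemma is_flat_iff_hyperplane:
  fixes X :: "(bit ^ 'n) set"
  shows "is_flat (CARD('n) - 1) X \<longleftrightarrow> (\<exists>a c. a \<noteq> 0 \<and> X = hyperplane a c)"
proof
  assume "is_flat (CARD('n) - 1) X"
  then obtain p W where "vec.subspace W" "vec.dim W = CARD('n) - 1" "X = (+) p ` W"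
    by (auto simp: is_flat_def)
  then show "\<exists>a c. a \<noteq> 0 \<and> X = hyperplane a c"
    using subspace_eq_hyperplane hyperplane_translate by metis
next
  assume "\<exists>a c. a \<noteq> 0 \<and> X = hyperplane a c"
  then obtain a c where a: "a \<noteq> 0" and X: "X = hyperplane a c"
    by blast
  obtain p where "dot a p = c"
    using dot_surj [OF a] by blast
  then have "X = (+) p ` hyperplane a 0"
    by (simp add: X hyperplane_translate)
  moreover have "vec.dim (hyperplane a 0) = CARD('n) - 1"
    using card_hyperplane [OF a] card_subspace_bit [OF subspace_hyperplane, of a] by simp
  ultimately show "is_flat (CARD('n) - 1) X"
    unfolding is_flat_def using subspace_hyperplane by blast
qed

section \<open>Counting preserved flats by functionals\<close>

lemma hyperplane_eq_iff: "hyperplane a c = hyperplane b d \<longleftrightarrow> a = b \<and> c = d"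
proof
  assume "hyperplane a c = hyperplane b d"
  \<comment> \<open>For bits, \<open>u = c \<longleftrightarrow> v = d\<close> is the single
    equation \<open>u + c = v + d\<close>.\<close>
  then have *: "dot a x + c = dot b x + d" for x
  proof -
    have "dot a x = c \<longleftrightarrow> dot b x = d"
      using \<open>hyperplane a c = hyperplane b d\<close> by (auto simp: hyperplane_def)
    then show ?thesis
      by (cases "dot a x"; cases "dot b x"; cases c; cases d) simp_all
  qed
  then have "c = d"
    using * [of 0] by simp
  with * show "a = b \<and> c = d"
    by (simp flip: dot_eq_iff)
qed simp

text \<open>Pulling back along \<open>f\<close> makes the condition pointwise. Since
  \<open>c\<close> enters only through \<open>c + d\<close>, changing \<open>c\<close> is absorbed
  by \<open>d\<close>: parallel hyperplanes are preserved together.\<close>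

lemma image_hyperplane_eq_iff:
  assumes "bij f"
  shows "f ` hyperplane a c = hyperplane b d \<longleftrightarrow> (\<forall>x. dot a x = dot b (f x) + (c + d))"
proof -
  have "f ` hyperplane a c = hyperplane b d \<longleftrightarrow> hyperplane a c = f -` hyperplane b d"
    using assms by (metis bij_def inj_vimage_image_eq surj_image_vimage_eq)
  also have "\<dots> \<longleftrightarrow> (\<forall>x. dot a x = c \<longleftrightarrow> dot b (f x) = d)"
    by (auto simp: hyperplane_def)
  also have "\<dots> \<longleftrightarrow> (\<forall>x. dot a x = dot b (f x) + (c + d))"
  proof -
    have "(dot a x = c \<longleftrightarrow> dot b (f x) = d) \<longleftrightarrow> dot a x = dot b (f x) + (c + d)" for x
      by (cases "dot a x"; cases "dot b (f x)"; cases c; cases d) simp_all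
    then show ?thesis by simp
  qed
  finally show ?thesis .
qed

lemma zero_mem_affine_preserved: "0 \<in> affine_preserved f"
  unfolding affine_preserved_def by (intro CollectI exI [of _ 0]) simp

lemma affinity_eq_card:
  fixes f :: "bit ^ 'n \<Rightarrow> bit ^ 'n"
  assumes f: "bij f"
  shows "affinity (CARD('n) - 1) f = 2 * card (affine_preserved f) - 2"
proof -
  have pres: "is_flat (CARD('n) - 1) (f ` hyperplane a c) \<longleftrightarrow> a \<in> affine_preserved f"
    if "a \<noteq> 0" for a c
  proof
    assume "is_flat (CARD('n) - 1) (f ` hyperplane a c)"
    then show "a \<in> affine_preserved f"
      unfolding is_flat_iff_hyperplane image_hyperplane_eq_iff [OF f] affine_preserved_def
      by blast
  next
    assume "a \<in> affine_preserved f"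
    then obtain b d where bd: "\<forall>x. dot a x = dot b (f x) + d"
      by (auto simp: affine_preserved_def)
    \<comment> \<open>Otherwise \<open>dot a\<close> would be constant, but for
      \<open>a \<noteq> 0\<close> it takes both values.\<close>
    have "b \<noteq> 0"
      using bd dot_surj [OF that, of 0] dot_surj [OF that, of 1] by force
    moreover have "f ` hyperplane a c = hyperplane b (c + d)"
      using bd by (simp add: image_hyperplane_eq_iff [OF f] add.assoc [symmetric])
    ultimately show "is_flat (CARD('n) - 1) (f ` hyperplane a c)"
      using is_flat_iff_hyperplane by blast
  qed
  have "{X. is_flat (CARD('n) - 1) X \<and> is_flat (CARD('n) - 1) (f ` X)} =
      case_prod hyperplane ` ((affine_preserved f - {0}) \<times> UNIV)"
  proof (intro set_eqI iffI)
    fix X assume X: "X \<in> {X. is_flat (CARD('n) - 1) X \<and> is_flat (CARD('n) - 1) (f ` X)}"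
    then obtain a c where "a \<noteq> 0" "X = hyperplane a c"
      using is_flat_iff_hyperplane by blast
    with X pres show "X \<in> case_prod hyperplane ` ((affine_preserved f - {0}) \<times> UNIV)"
      by force
  next
    fix X assume "X \<in> case_prod hyperplane ` ((affine_preserved f - {0}) \<times> UNIV)"
    then obtain a c where "a \<in> affine_preserved f" "a \<noteq> 0" "X = hyperplane a c"
      by auto
    with pres [of a c] show "X \<in> {X. is_flat (CARD('n) - 1) X \<and> is_flat (CARD('n) - 1) (f ` X)}"
      using is_flat_iff_hyperplane by blast
  qed
  moreover have "inj_on (case_prod hyperplane) A" for A :: "((bit ^ 'n) \<times> bit) set"
    by (auto simp: inj_on_def hyperplane_eq_iff)
  \<comment> \<open>Membership of 0 makes its removal cost exactly one functional, that is, two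
    pairs \<open>(0, c)\<close>.\<close>
  moreover note zero_mem_affine_preserved [of f]
  ultimately show ?thesis
    by (simp add: affinity_def card_image card_cartesian_product diff_mult_distrib)
qed

lemma subspace_affine_preserved: "vec.subspace (affine_preserved f)"
proof (rule vec.subspaceI)
  show "0 \<in> affine_preserved f"
    by (rule zero_mem_affine_preserved)
  show "a + a' \<in> affine_preserved f"
    if "a \<in> affine_preserved f" "a' \<in> affine_preserved f" for a a'
  proof -
    from that obtain b d b' d'
      where "\<forall>x. dot a x = dot b (f x) + d" "\<forall>x. dot a' x = dot b' (f x) + d'"
      by (auto simp: affine_preserved_def)
    then have "\<forall>x. dot (a + a') x = dot (b + b') (f x) + (d + d')"
      by (simp add: dot_add_left ac_simps)
    then show ?thesis
      unfolding affine_preserved_def by blast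
  qed
  show "k *s a \<in> affine_preserved f" if "a \<in> affine_preserved f" for k a
    using that zero_mem_affine_preserved by (cases k) simp_all
qed

section \<open>Permutations that attain each value\<close>

text \<open>The last clause captures a single cycle on \<open>T\<close> in the form used later:
  invariant functions are constant on \<open>T\<close>.\<close>

lemma exists_cycle_on:
  assumes "finite T"
  shows "\<exists>p. bij p \<and> (\<forall>x. x \<notin> T \<longrightarrow> p x = x) \<and>
    (\<forall>g :: 'a \<Rightarrow> 'b. (\<forall>x. g (p x) = g x) \<longrightarrow> (\<forall>x\<in>T. \<forall>y\<in>T. g x = g y))"
  using assms
proof (induction rule: finite_induct)
  case empty
  then show ?case by (intro exI [of _ id]) (simp add: bij_id [unfolded id_def])
next
  case (insert s T)
  then obtain p where p: "bij p" "\<And>x. x \<notin> T \<Longrightarrow> p x = x"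
    and inv: "\<And>g :: 'a \<Rightarrow> 'b. (\<forall>x. g (p x) = g x) \<Longrightarrow> \<forall>x\<in>T. \<forall>y\<in>T. g x = g y"
    by blast
  show ?case
  proof (cases "T = {}")
    case True
    then show ?thesis by (intro exI [of _ id]) (simp add: bij_id [unfolded id_def])
  next
    case False
    then obtain t where t: "t \<in> T" by blast
    with insert have [simp]: "s \<noteq> t" "p s = s"
      by (auto simp: p)
    \<comment> \<open>This sends \<open>t\<close> to \<open>s\<close> and \<open>s\<close> to
      \<open>p t\<close>, so \<open>s\<close> is inserted into the cycle right after
      \<open>t\<close>.\<close>
    let ?q = "p \<circ> Transposition.transpose s t"
    have "g x = g y" if g: "\<forall>x. g (?q x) = g x" and "x \<in> insert s T" "y \<in> insert s T"
      for g :: "'a \<Rightarrow> 'b" and x y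
    proof -
      have st: "g s = g t"
        using g [rule_format, of t] by simp
      \<comment> \<open>Invariance under \<open>?q\<close> passes to \<open>p\<close>: the two maps
        differ only at \<open>s\<close> and \<open>t\<close>, where \<open>g\<close> agrees.\<close>
      have "g (p z) = g z" for z
      proof -
        consider "z = s" | "z = t" | "z \<noteq> s" "z \<noteq> t" by blast
        then show ?thesis
        proof cases
          case 2
          then show ?thesis
            using g [rule_format, of s] st by simp
        next
          case 3
          then show ?thesis
            using g [rule_format, of z] by simp
        qed simp
      qed
      then have "\<forall>x\<in>T. g x = g t"
        using inv t by blast
      with st that(2,3) show ?thesis
        by auto
    qed
    moreover have "bij ?q"
      using p by (simp add: bij_comp)
    moreover have "?q x = x" if "x \<notin> insert s T" for x
      using that t by (auto simp: Transposition.transpose_def p)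
    ultimately show ?thesis by blast
  qed
qed

text \<open>Adding a third unit vector to a sum of two leaves the value \<open>d\<close> unchanged,
  so each coordinate of \<open>h\<close> vanishes; this takes three distinct indices.\<close>

lemma affine_zero_of_weight_ge_2:
  fixes h :: "bit ^ 'n"
  assumes n: "CARD('n) > 2"
    and zero: "\<And>x. x \<notin> insert 0 (range (\<lambda>i. axis i 1)) \<Longrightarrow> dot h x = d"
  shows "h = 0 \<and> d = 0"
proof -
  have heavy: "x \<notin> insert 0 (range (\<lambda>i. axis i 1))" if "x $ i = 1" "x $ j = 1" "i \<noteq> j"
    for x :: "bit ^ 'n" and i j
    using that by (auto simp: axis_def split: if_splits)
  have two: "h $ i + h $ j = d" if "i \<noteq> j" for i j
    using zero [OF heavy, of "axis i 1 + axis j 1" i j] that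
    by (simp add: dot_add_right axis_index_if)
  have three: "h $ i + h $ j + h $ k = d" if "i \<noteq> j" "i \<noteq> k" "j \<noteq> k" for i j k
    using zero [OF heavy, of "axis i 1 + axis j 1 + axis k 1" i j] that
    by (simp add: dot_add_right axis_index_if)
  have others: "\<exists>i j. i \<noteq> j \<and> i \<noteq> k \<and> j \<noteq> k" for k :: 'n
  proof -
    have "2 \<le> card (UNIV - {k})"
      using n by (simp add: card_Diff_singleton)
    then obtain S where "S \<subseteq> UNIV - {k}" "card S = 2"
      by (rule obtain_subset_with_card_n)
    then show ?thesis
      by (auto simp: card_2_iff)
  qed
  have comp: "h $ k = 0" for k
  proof -
    obtain i j where "i \<noteq> j" "i \<noteq> k" "j \<noteq> k"
      using others by blast
    with two [of i j] three [of i j k] have "d + h $ k = d"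
      by simp
    then show ?thesis by simp
  qed
  obtain i j :: 'n where "i \<noteq> j"
    using others by blast
  with two [of i j] comp show ?thesis
    by (simp add: vec_eq_iff)
qed

lemma card_vec_vanishing_on:
  "card {a :: bit ^ 'n. \<forall>i\<in>M. a $ i = 0} = 2 ^ (CARD('n) - card M)"
proof -
  have "bij_betw (\<lambda>a. {i. a $ i = 1}) {a :: bit ^ 'n. \<forall>i\<in>M. a $ i = 0} (Pow (- M))"
    by (rule bij_betw_byWitness [where f' = "\<lambda>S. \<chi> i. if i \<in> S then 1 else 0"])
      (auto simp: vec_eq_iff)
  then show ?thesis
    by (simp add: bij_betw_same_card card_Pow Compl_eq_Diff_UNIV card_Diff_subset)
qed

lemma exists_bij_card_affine_preserved:
  fixes M :: "'n::finite set"
  assumes n: "CARD('n) > 2"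
  shows "\<exists>f :: bit ^ 'n \<Rightarrow> bit ^ 'n. bij f \<and> card (affine_preserved f) = 2 ^ (CARD('n) - card M)"
proof -
  \<comment> \<open>Including 0 fixes the common value of an invariant functional on
    \<open>T\<close> as \<open>dot a 0 = 0\<close>, which forces \<open>a $ i = 0\<close> on
    \<open>M\<close>.\<close>
  define T :: "(bit ^ 'n) set" where "T = insert 0 ((\<lambda>i. axis i 1) ` M)"
  obtain p where p: "bij p" "\<And>x. x \<notin> T \<Longrightarrow> p x = x"
    and inv: "\<And>g :: bit ^ 'n \<Rightarrow> bit. (\<forall>x. g (p x) = g x) \<Longrightarrow> \<forall>x\<in>T. \<forall>y\<in>T. g x = g y"
    using exists_cycle_on [of T] by (metis finite)
  \<comment> \<open>If \<open>p x\<close> were outside \<open>T\<close>, it would be fixed, and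
    injectivity would give \<open>p x = x\<close>.\<close>
  have pT: "p x \<in> T" if "x \<in> T" for x
    using that p by (metis bij_is_inj injD)
  have "affine_preserved p = {a. \<forall>i\<in>M. a $ i = 0}"
  proof (intro set_eqI iffI)
    fix a assume "a \<in> affine_preserved p"
    then obtain b d where bd: "\<And>x. dot a x = dot b (p x) + d"
      by (auto simp: affine_preserved_def)
    have "dot (a + b) x = d" if "x \<notin> insert 0 (range (\<lambda>i. axis i 1))" for x
    proof -
      from that have "x \<notin> T"
        by (auto simp: T_def)
      with bd [of x] show ?thesis
        by (simp add: p dot_add_left add.assoc [symmetric])
    qed
    from affine_zero_of_weight_ge_2 [OF n this] have "a + b = 0" "d = 0"
      by auto
    then have "b = a"
      by (metis add.right_neutral bit_vec_add_cancel)
    with bd \<open>d = 0\<close> have "\<forall>x. dot a (p x) = dot a x"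
      by simp
    from inv [OF this] show "a \<in> {a. \<forall>i\<in>M. a $ i = 0}"
      by (auto simp: T_def)
  next
    fix a :: "bit ^ 'n" assume "a \<in> {a. \<forall>i\<in>M. a $ i = 0}"
    \<comment> \<open>\<open>dot a\<close> vanishes on \<open>T\<close>, which \<open>p\<close> maps
      into itself, and \<open>p\<close> is the identity elsewhere; so \<open>b = a\<close>,
      \<open>d = 0\<close> are witnesses.\<close>
    then have "dot a x = 0" if "x \<in> T" for x
      using that by (auto simp: T_def)
    then have "dot a x = dot a (p x) + 0" for x
      using p(2) [of x] pT [of x] by (cases "x \<in> T") simp_all
    then show "a \<in> affine_preserved p"
      unfolding affine_preserved_def by blast
  qed
  with p(1) card_vec_vanishing_on [of M] show ?thesis
    by auto
qed

theorem theorem5p2: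
  assumes "CARD('n::finite) > 2"
  shows "{affinity (CARD('n) - 1) f | f :: bit ^ 'n \<Rightarrow> bit ^ 'n. bij f}
       = {2 ^ i - 2 | i :: nat. 1 \<le> i \<and> i \<le> CARD('n) + 1}"
proof (intro set_eqI iffI)
  fix v assume "v \<in> {affinity (CARD('n) - 1) f | f :: bit ^ 'n \<Rightarrow> bit ^ 'n. bij f}"
  then obtain f :: "bit ^ 'n \<Rightarrow> bit ^ 'n" where f: "bij f" "v = affinity (CARD('n) - 1) f"
    by blast
  \<comment> \<open>The exponent is \<open>i = k + 1\<close>, the extra factor 2 coming from the two
    parallel flats of each functional; \<open>0 \<le> k \<le> n\<close> gives the range of
    \<open>i\<close>.\<close>
  define k where "k = vec.dim (affine_preserved f)"
  have "v = 2 ^ (k + 1) - 2"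
    unfolding f(2) affinity_eq_card [OF f(1)] k_def
      card_subspace_bit [OF subspace_affine_preserved] by simp
  moreover have "k \<le> CARD('n)"
    unfolding k_def using vec.dim_subset_UNIV [of "affine_preserved f"] by (simp add: vec.dimension_def card_cart_basis)
  ultimately show "v \<in> {2 ^ i - 2 | i :: nat. 1 \<le> i \<and> i \<le> CARD('n) + 1}"
    by (intro CollectI exI [of _ "k + 1"]) simp
next
  fix v assume "v \<in> {2 ^ i - 2 :: nat | i :: nat. 1 \<le> i \<and> i \<le> CARD('n) + 1}"
  then obtain i where i: "1 \<le> i" "i \<le> CARD('n) + 1" "v = 2 ^ i - 2"
    by blast
  \<comment> \<open>The size is chosen so that \<open>CARD('n) - card M = i - 1\<close>; the bound
    on \<open>i\<close> makes the truncated subtraction exact.\<close>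
  obtain M :: "'n set" where M: "card M = CARD('n) - (i - 1)"
    using obtain_subset_with_card_n [of "CARD('n) - (i - 1)" "UNIV :: 'n set"] by auto
  obtain f :: "bit ^ 'n \<Rightarrow> bit ^ 'n"
    where f: "bij f" "card (affine_preserved f) = 2 ^ (CARD('n) - card M)"
    using exists_bij_card_affine_preserved [OF assms] by blast
  have "CARD('n) - card M = i - 1"
    using M i by simp
  then have "affinity (CARD('n) - 1) f = v"
    unfolding affinity_eq_card [OF f(1)] f(2) i(3) using i(1) by (simp flip: power_Suc)
  with f show "v \<in> {affinity (CARD('n) - 1) f | f :: bit ^ 'n \<Rightarrow> bit ^ 'n. bij f}"
    by blast
qed

end
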